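(* Let $f:\mathbb{R}^n\to\,]-\infty,+\infty]$ and $g:\mathbb{R}^m\to\,]-\infty,+\infty]$ be convex, closed and proper, let $\bm{A}\in\mathbb{R}^{p\times n}$ and $\bm{B}\in\mathbb{R}^{p\times m}$ have full column rank, and let $\bm{c}\in\mathbb{R}^p$. The standard primal problem $$\underset{\bm{x},\bm{z}}{\text{minimize}}\ \ f(\bm{x})+g(\bm{z})\quad\text{subject to}\quad\bm{A}\bm{x}-\bm{B}\bm{z}=\bm{c}$$ admits the following unified characterizations of itself and of its Fenchel dual problem: $$(\text{Primal})\quad\underset{\widetilde{\bm{x}}}{\text{minimize}}\ \ \widetilde f(\widetilde{\bm{x}})+\widetilde g(\widetilde{\bm{x}}-\widetilde{\bm{c}}),$$ $$(\text{Dual})\quad\underset{\widetilde{\bm{\lambda}}}{\text{minimize}}\ \ \big(\widetilde f\circ(-\mathcal{I})\big)^*(\widetilde{\bm{\lambda}})+\widetilde g^*(\widetilde{\bm{\lambda}}-\widetilde{\bm{c}}),$$ under either of the following substitutions: (a) (equilibrate parametrization) for any bijective bounded linear operator $\mathcal{S}$ on $\mathbb{R}^p$: $\widetilde f=f\circ(\mathcal{S}\bm{A})^{-1}$, $\widetilde g=g\circ(\mathcal{S}\bm{B})^{-1}$, $\widetilde{\bm{x}}=\mathcal{S}\bm{A}\bm{x}$, $\widetilde{\bm{\lambda}}=(\mathcal{S}^* )^{-1}\bm{\lambda}$, $\widetilde{\bm{c}}=\mathcal{S}\bm{c}$; (b) (classical parametrization) for any scalar $\gamma>0$: $\widetilde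 f=\frac1\gamma f\circ\bm{A}^{-1}$, $\widetilde g=\frac1\gamma g\circ\bm{B}^{-1}$, $\widetilde{\bm{x}}=\bm{A}\bm{x}$, $\widetilde{\bm{\lambda}}=\frac1\gamma\bm{\lambda}$, $\widetilde{\bm{c}}=\bm{c}$. Moreover, in either case the standard problem admits the monotone inclusion characterizations $$\text{find }\widetilde{\bm{x}}\text{ such that }0\in\mathcal{A}(\widetilde{\bm{x}})+\mathcal{B}(\widetilde{\bm{x}}-\widetilde{\bm{c}}),\qquad \text{find }\widetilde{\bm{\lambda}}\text{ such that }0\in\mathcal{A}'^{-1}(\widetilde{\bm{\lambda}})+\mathcal{B}^{-1}(\widetilde{\bm{\lambda}}-\widetilde{\bm{c}}),$$ where $\mathcal{A}=\partial\widetilde f$, $\mathcal{B}=\partial\widetilde g$.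
   Context: $\mathcal{I}$ is the identity operator, $h^*(\bm{u})=\sup_{\bm{z}}\langle\bm{z},\bm{u}\rangle-h(\bm{z})$ is the Fenchel conjugate, and $\mathcal{A}'^{-1}=(\mathcal{A}\circ(-\mathcal{I}))^{-1}=(-\mathcal{I})\circ\mathcal{A}^{-1}\circ(-\mathcal{I})$ (Attouch–Théra dual). For an injective matrix $\bm{D}$, $f\circ\bm{D}^{-1}$ denotes the function $\bm{y}\mapsto f(\bm{x})$ if $\bm{y}=\bm{D}\bm{x}$ and $+\infty$ if $\bm{y}$ is not in the range of $\bm{D}$. The Lagrangian of the standard problem is $f(\bm{x})+g(\bm{z})+\langle\bm{\lambda},\bm{A}\bm{x}-\bm{B}\bm{z}-\bm{c}\rangle$, and its Fenchel dual problem, written as a minimization, is $\text{minimize}_{\bm{\lambda}}\ f^*(-\bm{A}^T\bm{\lambda})+g^*(\bm{B}^T\bm{\lambda})+\langle\bm{\lambda},\bm{c}\rangle$. "Characterization" means that, under the stated change of variables, (Primal) is equivalent to the standard problem and (Dual) is equivalent to its Fenchel dual problem; likewise, the first inclusion characterizes the primal problem and the second the dual problem.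
   Formalization: The shift by c̃ is applied before conjugating/inverting: the dual terms are g̃*(λ̃)+⟨λ̃,c̃⟩ and c̃+B⁻¹(λ̃). A'⁻¹ is (−I)∘A⁻¹∘(−I). Inclusion solutions are the saddle points; they are shown to be all primal/dual minimizers only if a saddle point exists. *)

theory Defs
  imports "HOL-Analysis.Analysis"
begin

section \<open>Extended-real-valued convex functions\<close>

definition ext_epigraph :: "('a \<Rightarrow> ereal) \<Rightarrow> ('a \<times> real) set" where
  "ext_epigraph h = {(x, r). h x \<le> ereal r}"

definition proper_fun :: "('a \<Rightarrow> ereal) \<Rightarrow> bool" where
  "proper_fun h \<longleftrightarrow> (\<forall>x. h x \<noteq> -\<infinity>) \<and> (\<exists>x. h x < \<infinity>)"

definition convex_closed_proper :: "('a::euclidean_space \<Rightarrow> ereal) \<Rightarrow> bool" where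
  "convex_closed_proper h \<longleftrightarrow>
     convex (ext_epigraph h) \<and> closed (ext_epigraph h) \<and> proper_fun h"

definition fenchel_conj :: "('a::euclidean_space \<Rightarrow> ereal) \<Rightarrow> 'a \<Rightarrow> ereal" where
  "fenchel_conj h u = (SUP z. ereal (z \<bullet> u) - h z)"

definition subdifferential :: "('a::euclidean_space \<Rightarrow> ereal) \<Rightarrow> 'a \<Rightarrow> 'a set" where
  "subdifferential h x = {u. \<forall>y. h x + ereal (u \<bullet> (y - x)) \<le> h y}"

text \<open>The function written \<open>h \<circ> D\<^sup>-\<^sup>1\<close>; meant for injective \<open>D\<close>.\<close>

definition comp_inverse :: "('a \<Rightarrow> ereal) \<Rightarrow> ('a \<Rightarrow> 'b) \<Rightarrow> 'b \<Rightarrow> ereal" where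
  "comp_inverse h D y = (if y \<in> range D then h (inv D y) else \<infinity>)"

section \<open>Set-valued operators\<close>

definition op_inverse :: "('a \<Rightarrow> 'b set) \<Rightarrow> 'b \<Rightarrow> 'a set" where
  "op_inverse T u = {x. u \<in> T x}"

text \<open>The Attouch--Thera dual \<open>(-I) \<circ> T\<^sup>-\<^sup>1 \<circ> (-I)\<close>.\<close>

definition attouch_thera_inverse ::
    "('a::euclidean_space \<Rightarrow> 'a set) \<Rightarrow> 'a \<Rightarrow> 'a set" where
  "attouch_thera_inverse T u = uminus ` op_inverse T (- u)"

definition monotone_operator :: "('a::euclidean_space \<Rightarrow> 'a set) \<Rightarrow> bool" where
  "monotone_operator T \<longleftrightarrow>
     (\<forall>x y. \<forall>u\<in>T x. \<forall>v\<in>T y. 0 \<le> (x - y) \<bullet> (u - v))"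

section \<open>Minimization problems\<close>

text \<open>The problem of minimizing \<open>F\<close> over \<open>C\<close> is given by the pair \<open>C\<close>, \<open>F\<close>. An infeasible
  problem (\<open>F = \<infinity>\<close> throughout \<open>C\<close>) has no solutions.\<close>

definition argmin_set :: "'a set \<Rightarrow> ('a \<Rightarrow> ereal) \<Rightarrow> 'a set" where
  "argmin_set C F = {v \<in> C. F v < \<infinity> \<and> (\<forall>w\<in>C. F v \<le> F w)}"

text \<open>Equivalence under the change of variables \<open>\<Phi>\<close>, the objective being multiplied by \<open>\<kappa>\<close>.\<close>

definition equivalent_problems ::
    "real \<Rightarrow> ('a \<Rightarrow> 'b) \<Rightarrow> 'a set \<Rightarrow> ('a \<Rightarrow> ereal) \<Rightarrow> 'b set \<Rightarrow> ('b \<Rightarrow> ereal) \<Rightarrow> bool" where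
  "equivalent_problems \<kappa> \<Phi> C F D G \<longleftrightarrow>
     0 < \<kappa> \<and>
     (\<forall>v\<in>C. \<Phi> v \<in> D \<and> G (\<Phi> v) = ereal \<kappa> * F v) \<and>
     bij_betw \<Phi> {v \<in> C. F v < \<infinity>} {w \<in> D. G w < \<infinity>} \<and>
     (INF w\<in>D. G w) = ereal \<kappa> * (INF v\<in>C. F v) \<and>
     bij_betw \<Phi> (argmin_set C F) (argmin_set D G)"

section \<open>The standard problem and its dual\<close>

definition standard_feasible ::
    "real^'n^'p \<Rightarrow> real^'m^'p \<Rightarrow> real^'p \<Rightarrow> ((real^'n) \<times> (real^'m)) set" where
  "standard_feasible A B c = {(x, z). A *v x - B *v z = c}"

definition standard_objective ::
    "(real^'n \<Rightarrow> ereal) \<Rightarrow> (real^'m \<Rightarrow> ereal) \<Rightarrow> (real^'n) \<times> (real^'m) \<Rightarrow> ereal" where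
  "standard_objective f g = (\<lambda>(x, z). f x + g z)"

definition lagrangian ::
    "(real^'n \<Rightarrow> ereal) \<Rightarrow> (real^'m \<Rightarrow> ereal) \<Rightarrow> real^'n^'p \<Rightarrow> real^'m^'p \<Rightarrow> real^'p
      \<Rightarrow> real^'n \<Rightarrow> real^'m \<Rightarrow> real^'p \<Rightarrow> ereal" where
  "lagrangian f g A B c x z l = f x + g z + ereal (l \<bullet> (A *v x - B *v z - c))"

definition saddle_points ::
    "(real^'n \<Rightarrow> ereal) \<Rightarrow> (real^'m \<Rightarrow> ereal) \<Rightarrow> real^'n^'p \<Rightarrow> real^'m^'p \<Rightarrow> real^'p
      \<Rightarrow> ((real^'n) \<times> (real^'m) \<times> (real^'p)) set" where
  "saddle_points f g A B c = {(x, z, l).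
     (\<forall>l'. lagrangian f g A B c x z l' \<le> lagrangian f g A B c x z l) \<and>
     (\<forall>x' z'. lagrangian f g A B c x z l \<le> lagrangian f g A B c x' z' l)}"

definition fenchel_dual_objective ::
    "(real^'n \<Rightarrow> ereal) \<Rightarrow> (real^'m \<Rightarrow> ereal) \<Rightarrow> real^'n^'p \<Rightarrow> real^'m^'p \<Rightarrow> real^'p
      \<Rightarrow> real^'p \<Rightarrow> ereal" where
  "fenchel_dual_objective f g A B c l =
     fenchel_conj f (- (transpose A *v l)) + fenchel_conj g (transpose B *v l) + ereal (l \<bullet> c)"

section \<open>The unified form\<close>

definition unified_primal ::
    "('a::euclidean_space \<Rightarrow> ereal) \<Rightarrow> ('a \<Rightarrow> ereal) \<Rightarrow> 'a \<Rightarrow> 'a \<Rightarrow> ereal" where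
  "unified_primal f g c x = f x + g (x - c)"

text \<open>In the two dual objects below the translation by \<open>c\<close> is applied before conjugating,
  respectively inverting: the conjugate of \<open>g(\<cdot> - c)\<close> at \<open>l\<close> is \<open>g\<^sup>*(l) + \<langle>l, c\<rangle>\<close>, and the inverse
  of \<open>T(\<cdot> - c)\<close> at \<open>l\<close> is \<open>c + T\<^sup>-\<^sup>1(l)\<close>. Translating the argument of \<open>g\<^sup>*\<close> or \<open>T\<^sup>-\<^sup>1\<close> instead would
  not give the dual of \<open>unified_primal\<close> unless \<open>c = 0\<close>.\<close>

definition unified_dual ::
    "('a::euclidean_space \<Rightarrow> ereal) \<Rightarrow> ('a \<Rightarrow> ereal) \<Rightarrow> 'a \<Rightarrow> 'a \<Rightarrow> ereal" where
  "unified_dual f g c l = fenchel_conj (f \<circ> uminus) l + fenchel_conj (\<lambda>x. g (x - c)) l"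

definition primal_inclusion_solutions ::
    "('a::euclidean_space \<Rightarrow> 'a set) \<Rightarrow> ('a \<Rightarrow> 'a set) \<Rightarrow> 'a \<Rightarrow> 'a set" where
  "primal_inclusion_solutions S T c = {x. 0 \<in> S x + T (x - c)}"

definition dual_inclusion_solutions ::
    "('a::euclidean_space \<Rightarrow> 'a set) \<Rightarrow> ('a \<Rightarrow> 'a set) \<Rightarrow> 'a \<Rightarrow> 'a set" where
  "dual_inclusion_solutions S T c =
     {l. 0 \<in> attouch_thera_inverse S l + op_inverse (\<lambda>x. T (x - c)) l}"

end

theory Submission
  imports Defs
begin

text \<open>Both substitutions have the form \<open>f~ = \<kappa> f \<circ> (S A)\<^sup>-\<^sup>1\<close>, \<open>g~ = \<kappa> g \<circ> (S B)\<^sup>-\<^sup>1\<close> with \<open>\<kappa> > 0\<close> and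
  bijections \<open>S\<close>, \<open>\<Lambda>\<close> satisfying \<open>\<langle>\<Lambda> l, S y\<rangle> = \<kappa> \<langle>l, y\<rangle>\<close>. The inclusions hold at a pair
  \<open>(S A x, \<Lambda> l)\<close> exactly when \<open>(x, z, l)\<close> is a Karush--Kuhn--Tucker point, that is, a saddle point
  of the Lagrangian, where \<open>z\<close> is determined by the constraint. A saddle point forces strong
  duality by equality in Fenchel's inequality, so it can be recombined with any other primal or
  dual solution.\<close>

section \<open>Extended-real-valued functions\<close>

lemma comp_inverse_apply: "inj D \<Longrightarrow> comp_inverse h D (D x) = h x"
  by (simp add: comp_inverse_def)

lemma comp_inverse_outside: "y \<notin> range D \<Longrightarrow> comp_inverse h D y = \<infinity>"
  by (simp add: comp_inverse_def)

lemma proper_fun_not_MInf: "proper_fun h \<Longrightarrow> h x \<noteq> -\<infinity>"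
  by (simp add: proper_fun_def)

lemma proper_fun_scaled_comp_inverse:
  assumes "proper_fun h" and "inj D" and "0 < \<kappa>"
  shows "proper_fun (\<lambda>y. ereal \<kappa> * comp_inverse h D y)"
  unfolding proper_fun_def
proof (intro conjI allI)
  fix y
  show "ereal \<kappa> * comp_inverse h D y \<noteq> -\<infinity>"
    using assms(3) proper_fun_not_MInf[OF assms(1), of "inv D y"]
    by (cases "h (inv D y)") (auto simp: comp_inverse_def)
next
  obtain x where "h x < \<infinity>"
    using assms(1) by (auto simp: proper_fun_def)
  then have "ereal \<kappa> * comp_inverse h D (D x) < \<infinity>"
    using assms(3) by (cases "h x") (auto simp: comp_inverse_apply[OF assms(2)])
  then show "\<exists>y. ereal \<kappa> * comp_inverse h D y < \<infinity>" ..
qed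

text \<open>The definition of \<open>subdifferential\<close> allows an infinite value at
  \<open>x\<close>; properness excludes it, since the subgradient inequality tested at a point of
  finite value bounds \<open>h x\<close> from above.\<close>

lemma subdifferential_imp_finite:
  assumes "proper_fun h" and "u \<in> subdifferential h x"
  shows "h x < \<infinity>"
proof -
  obtain y where "h y < \<infinity>"
    using assms(1) by (auto simp: proper_fun_def)
  moreover have "h x + ereal (u \<bullet> (y - x)) \<le> h y"
    using assms(2) by (simp add: subdifferential_def)
  ultimately show ?thesis
    by (cases "h x") auto
qed

text \<open>Add the two subgradient inequalities, each tested at the other point; the function
  values are finite and cancel.\<close>

lemma monotone_subdifferential:
  assumes "proper_fun h"
  shows "monotone_operator (subdifferential h)"
  unfolding monotone_operator_def
proof (intro allI ballI)
  fix x y u v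
  assume u: "u \<in> subdifferential h x" and v: "v \<in> subdifferential h y"
  obtain a b where ab: "h x = ereal a" "h y = ereal b"
    using subdifferential_imp_finite[OF assms u] subdifferential_imp_finite[OF assms v]
      proper_fun_not_MInf[OF assms, of x] proper_fun_not_MInf[OF assms, of y]
    by (cases "h x"; cases "h y") auto
  have "h x + ereal (u \<bullet> (y - x)) \<le> h y" "h y + ereal (v \<bullet> (x - y)) \<le> h x"
    using u v by (auto simp: subdifferential_def)
  then have "a + u \<bullet> (y - x) \<le> b" "b + v \<bullet> (x - y) \<le> a"
    by (simp_all add: ab)
  then show "0 \<le> (x - y) \<bullet> (u - v)"
    by (simp add: inner_diff_left inner_diff_right inner_commute)
qed

text \<open>Off the range of \<open>D\<close> the function is \<infinity>, so the subgradient
  inequality only has to be tested at points \<open>D y\<close>; there \<open>adj\<close> turns it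
  into \<open>\<kappa>\<close> times the inequality for \<open>h\<close>.\<close>

lemma subdifferential_scaled_comp_inverse:
  assumes "inj D" and "0 < \<kappa>"
    and adj: "\<And>y. u \<bullet> (D y - D x) = \<kappa> * (v \<bullet> (y - x))"
  shows "u \<in> subdifferential (\<lambda>y. ereal \<kappa> * comp_inverse h D y) (D x) \<longleftrightarrow> v \<in> subdifferential h x"
    (is "u \<in> subdifferential ?H _ \<longleftrightarrow> _")
proof -
  have "?H y = \<infinity>" if "y \<notin> range D" for y
    using that assms(2) by (simp add: comp_inverse_outside)
  then have "u \<in> subdifferential ?H (D x) \<longleftrightarrow>
      (\<forall>y. ?H (D x) + ereal (u \<bullet> (D y - D x)) \<le> ?H (D y))"
    unfolding subdifferential_def mem_Collect_eq
    by (metis ereal_less_eq(1) rangeE)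
  also have "\<dots> \<longleftrightarrow> (\<forall>y. ereal \<kappa> * (h x + ereal (v \<bullet> (y - x))) \<le> ereal \<kappa> * h y)"
    using assms(2) by (simp add: comp_inverse_apply[OF assms(1)] adj ereal_pos_distrib)
  also have "\<dots> \<longleftrightarrow> v \<in> subdifferential h x"
    using assms(2) by (simp add: subdifferential_def ereal_mult_le_mult_iff)
  finally show ?thesis .
qed

section \<open>Fenchel conjugates\<close>

lemma fenchel_young: "ereal (z \<bullet> u) - h z \<le> fenchel_conj h u"
  unfolding fenchel_conj_def by (rule SUP_upper) simp

text \<open>The equality case of Fenchel-Young: the subgradient inequality says precisely that the
  supremum defining the conjugate is attained at \<open>x\<close>.\<close>

lemma fenchel_conj_subgradient:
  assumes "v \<in> subdifferential h x" and "h x = ereal a"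
  shows "fenchel_conj h v = ereal (x \<bullet> v - a)"
proof (rule antisym)
  show "fenchel_conj h v \<le> ereal (x \<bullet> v - a)"
    unfolding fenchel_conj_def
  proof (rule SUP_least)
    fix z
    have "h x + ereal (v \<bullet> (z - x)) \<le> h z"
      using assms(1) by (simp add: subdifferential_def)
    then show "ereal (z \<bullet> v) - h z \<le> ereal (x \<bullet> v - a)"
      using assms(2) by (cases "h z") (auto simp: inner_diff_right inner_commute)
  qed
  show "ereal (x \<bullet> v - a) \<le> fenchel_conj h v"
    using fenchel_young[of x v h] assms(2) by simp
qed

text \<open>Points off the range of \<open>D\<close> contribute -\<infinity> to the supremum, which
  therefore runs over \<open>D x\<close> only. The constant \<open>r\<close> admits affine maps
  \<open>D\<close>, so that a translation of the argument can be absorbed into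
  \<open>D\<close>.\<close>

lemma fenchel_conj_scaled_comp_inverse:
  assumes "inj D" and "0 < \<kappa>" and adj: "\<And>x. D x \<bullet> u = \<kappa> * (x \<bullet> v) + r"
  shows "fenchel_conj (\<lambda>y. ereal \<kappa> * comp_inverse h D y) u = ereal \<kappa> * fenchel_conj h v + ereal r"
    (is "fenchel_conj ?H u = _")
proof -
  have H: "ereal (D x \<bullet> u) - ?H (D x) = ereal \<kappa> * (ereal (x \<bullet> v) - h x) + ereal r" for x
    using assms(2) unfolding adj comp_inverse_apply[OF assms(1)]
    by (cases "h x") (auto simp: algebra_simps)
  have outside: "ereal (y \<bullet> u) - ?H y = -\<infinity>" if "y \<notin> range D" for y
    using that assms(2) by (simp add: comp_inverse_outside)
  have "fenchel_conj ?H u = (SUP x. ereal (D x \<bullet> u) - ?H (D x))"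
    unfolding fenchel_conj_def
  proof (rule antisym)
    show "(SUP y. ereal (y \<bullet> u) - ?H y) \<le> (SUP x. ereal (D x \<bullet> u) - ?H (D x))"
    proof (rule SUP_least)
      fix y
      show "ereal (y \<bullet> u) - ?H y \<le> (SUP x. ereal (D x \<bullet> u) - ?H (D x))"
      proof (cases "y \<in> range D")
        case True
        then obtain x where "y = D x" by blast
        then show ?thesis
          by (auto intro: SUP_upper2[of x])
      next
        case False
        then show ?thesis
          unfolding outside[OF False] by simp
      qed
    qed
  qed (auto intro!: SUP_least intro: SUP_upper2)
  also have "\<dots> = (SUP x. ereal \<kappa> * (ereal (x \<bullet> v) - h x)) + ereal r"
    unfolding H by (rule SUP_ereal_add_left) auto
  also have "\<dots> = ereal \<kappa> * fenchel_conj h v + ereal r"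
    unfolding fenchel_conj_def using assms(2) by (subst Sup_ereal_mult_left') auto
  finally show ?thesis .
qed

section \<open>Equivalence of minimization problems\<close>

text \<open>Points of \<open>D\<close> outside the image of \<open>\<Phi>\<close> have value
  \<infinity>, so they affect neither the effective domain, nor the infimum, nor the minimizers; on
  the image, \<open>G\<close> is a positive multiple of \<open>F\<close>.\<close>

lemma equivalent_problemsI:
  fixes F :: "'a \<Rightarrow> ereal" and G :: "'b \<Rightarrow> ereal"
  assumes \<kappa>: "0 < \<kappa>" and inj: "inj_on \<Phi> C" and maps: "\<And>v. v \<in> C \<Longrightarrow> \<Phi> v \<in> D"
    and G: "\<And>v. v \<in> C \<Longrightarrow> G (\<Phi> v) = ereal \<kappa> * F v"
    and outside: "\<And>w. w \<in> D \<Longrightarrow> w \<notin> \<Phi> ` C \<Longrightarrow> G w = \<infinity>"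
  shows "equivalent_problems \<kappa> \<Phi> C F D G"
proof -
  have le: "G (\<Phi> v) \<le> G (\<Phi> w) \<longleftrightarrow> F v \<le> F w" if "v \<in> C" "w \<in> C" for v w
    using that \<kappa> by (simp add: G ereal_mult_le_mult_iff)
  have fin: "G (\<Phi> v) < \<infinity> \<longleftrightarrow> F v < \<infinity>" if "v \<in> C" for v
    using that \<kappa> by (cases "F v") (auto simp: G)
  have dom: "\<Phi> ` {v \<in> C. F v < \<infinity>} = {w \<in> D. G w < \<infinity>}"
    using maps outside fin by force
  have lower: "(\<forall>w\<in>D. G (\<Phi> v) \<le> G w) \<longleftrightarrow> (\<forall>w\<in>C. F v \<le> F w)" if v: "v \<in> C" for v
  proof
    assume "\<forall>w\<in>D. G (\<Phi> v) \<le> G w"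
    then show "\<forall>w\<in>C. F v \<le> F w"
      using maps le v by blast
  next
    assume *: "\<forall>w\<in>C. F v \<le> F w"
    show "\<forall>w\<in>D. G (\<Phi> v) \<le> G w"
    proof
      fix w assume "w \<in> D"
      then show "G (\<Phi> v) \<le> G w"
        using outside[of w] le[OF v] * by (cases "w \<in> \<Phi> ` C") auto
    qed
  qed
  have "\<Phi> ` argmin_set C F = argmin_set D G"
  proof (intro equalityI subsetI)
    fix w assume "w \<in> \<Phi> ` argmin_set C F"
    then show "w \<in> argmin_set D G"
      using maps fin lower by (auto simp: argmin_set_def)
  next
    fix w assume w: "w \<in> argmin_set D G"
    \<comment> \<open>Membership in \<open>argmin_set\<close> includes a finite upper bound on the
      value, which forces \<open>w\<close> into the image.\<close>
    then obtain v where "v \<in> C" "w = \<Phi> v"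
      using outside[of w] by (auto simp: argmin_set_def)
    then show "w \<in> \<Phi> ` argmin_set C F"
      using w fin lower by (auto simp: argmin_set_def)
  qed
  moreover have "(INF w\<in>D. G w) = ereal \<kappa> * (INF v\<in>C. F v)"
  proof -
    have "(INF w\<in>D. G w) = (INF v\<in>C. G (\<Phi> v))"
    proof (rule antisym)
      show "(INF w\<in>D. G w) \<le> (INF v\<in>C. G (\<Phi> v))"
        by (rule INF_greatest) (auto intro: INF_lower maps)
      show "(INF v\<in>C. G (\<Phi> v)) \<le> (INF w\<in>D. G w)"
      proof (rule INF_greatest)
        fix w assume "w \<in> D"
        then show "(INF v\<in>C. G (\<Phi> v)) \<le> G w"
          using outside[of w] by (cases "w \<in> \<Phi> ` C") (auto intro: INF_lower)
      qed
    qed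
    \<comment> \<open>The set-builder form is the one to which \<open>ereal_Inf_cmult\<close>
      applies.\<close>
    also have "\<dots> = Inf {ereal \<kappa> * x |x. x \<in> F ` C}"
      by (rule arg_cong[where f = Inf]) (force simp: G)
    also have "\<dots> = ereal \<kappa> * (INF v\<in>C. F v)"
      by (subst ereal_Inf_cmult[OF \<kappa>]) simp
    finally show ?thesis .
  qed
  moreover have "inj_on \<Phi> {v \<in> C. F v < \<infinity>}" "inj_on \<Phi> (argmin_set C F)"
    using inj by (auto simp: argmin_set_def elim: inj_on_subset)
  ultimately show ?thesis
    unfolding equivalent_problems_def bij_betw_def using \<kappa> maps G dom by blast
qed

section \<open>Saddle points\<close>

text \<open>The right-hand side uses \<open>l v* A\<close>, the form to which the simplifier reduces
  \<open>transpose A *v l\<close>.\<close>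

lemma inner_matrix_eq: "(l :: real^'p) \<bullet> ((A :: real^'n^'p) *v x) = x \<bullet> (l v* A)"
  by (metis dot_lmul_matrix inner_commute)

context
  fixes f :: "real^'n \<Rightarrow> ereal" and g :: "real^'m \<Rightarrow> ereal"
    and A :: "real^'n^'p" and B :: "real^'m^'p" and c :: "real^'p"
  assumes f: "proper_fun f" and g: "proper_fun g"
begin

text \<open>The Lagrangian at a saddle point lies below its finite value at a pair taken from the
  two effective domains, which excludes \<infinity>; properness excludes -\<infinity>.\<close>

lemma saddle_point_finite:
  assumes "(x, z, l) \<in> saddle_points f g A B c"
  obtains a b where "f x = ereal a" and "g z = ereal b"
proof -
  obtain x0 z0 where "f x0 < \<infinity>" "g z0 < \<infinity>"
    using f g by (auto simp: proper_fun_def)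
  moreover have "lagrangian f g A B c x z l \<le> lagrangian f g A B c x0 z0 l"
    using assms by (auto simp: saddle_points_def)
  ultimately show thesis
    using that proper_fun_not_MInf[OF f, of x] proper_fun_not_MInf[OF g, of z]
      proper_fun_not_MInf[OF f, of x0] proper_fun_not_MInf[OF g, of z0]
    by (cases "f x"; cases "g z"; cases "f x0"; cases "g z0") (auto simp: lagrangian_def)
qed

lemma saddle_point_feasible:
  assumes "(x, z, l) \<in> saddle_points f g A B c"
  shows "A *v x - B *v z = c"
proof -
  obtain a b where ab: "f x = ereal a" "g z = ereal b"
    using saddle_point_finite[OF assms] .
  \<comment> \<open>Moving the multiplier along the constraint residual raises the Lagrangian by the
    squared norm of that residual, which maximality in \<open>l\<close> only permits if it
    vanishes.\<close>
  let ?r = "A *v x - B *v z - c"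
  have "lagrangian f g A B c x z (l + ?r) \<le> lagrangian f g A B c x z l"
    using assms by (auto simp: saddle_points_def)
  then have "?r \<bullet> ?r \<le> 0"
    by (simp add: lagrangian_def ab inner_add_left)
  then show ?thesis
    by (metis eq_iff_diff_eq_0 inner_eq_zero_iff inner_ge_zero order_antisym)
qed

text \<open>At a feasible pair the Lagrangian does not depend on the multiplier, so maximality in
  \<open>l\<close> amounts to feasibility and only minimality in \<open>(x, z)\<close>
  remains.\<close>

lemma saddle_point_iff_minimizer:
  "(x, z, l) \<in> saddle_points f g A B c \<longleftrightarrow>
    A *v x - B *v z = c \<and> (\<forall>x' z'. f x + g z \<le> lagrangian f g A B c x' z' l)" (is "?L \<longleftrightarrow> ?R")
proof
  assume L: ?L
  have feas: "A *v x - B *v z = c"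
    using saddle_point_feasible[OF L] .
  then have "lagrangian f g A B c x z l = f x + g z"
    by (simp add: lagrangian_def)
  then show ?R
    using L feas by (auto simp: saddle_points_def)
next
  assume R: ?R
  then have "lagrangian f g A B c x z l' = f x + g z" for l'
    by (simp add: lagrangian_def)
  with R show ?L
    by (simp add: saddle_points_def)
qed

text \<open>The Karush-Kuhn-Tucker conditions. For fixed \<open>l\<close> the Lagrangian is
  separable in \<open>x\<close> and \<open>z\<close>, so joint minimality splits into one
  subgradient condition for each variable.\<close>

lemma saddle_point_iff_subgradients:
  "(x, z, l) \<in> saddle_points f g A B c \<longleftrightarrow> A *v x - B *v z = c \<and>
     - (transpose A *v l) \<in> subdifferential f x \<and> transpose B *v l \<in> subdifferential g z"
  (is "?L \<longleftrightarrow> ?R")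
proof
  assume L: ?L
  obtain a b where ab: "f x = ereal a" "g z = ereal b"
    using saddle_point_finite[OF L] .
  have feas: "A *v x - B *v z = c" and min: "\<And>x' z'. f x + g z \<le> lagrangian f g A B c x' z' l"
    using L unfolding saddle_point_iff_minimizer by auto
  \<comment> \<open>Keep \<open>z\<close> fixed so that the finite value \<open>g z\<close> cancels;
    \<open>c\<close> is eliminated by feasibility.\<close>
  have "f x + ereal (- (transpose A *v l) \<bullet> (x' - x)) \<le> f x'" for x'
    using min[of x' z] feas[symmetric] ab
    by (cases "f x'")
      (auto simp: lagrangian_def inner_diff_right inner_matrix_eq inner_commute)
  moreover have "g z + ereal ((transpose B *v l) \<bullet> (z' - z)) \<le> g z'" for z'
    using min[of x z'] feas[symmetric] ab
    by (cases "g z'")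
      (auto simp: lagrangian_def inner_diff_right inner_matrix_eq inner_commute)
  ultimately show ?R
    using feas by (simp add: subdifferential_def)
next
  assume R: ?R
  then have feas: "A *v x - B *v z = c"
    and u: "- (transpose A *v l) \<in> subdifferential f x" and v: "transpose B *v l \<in> subdifferential g z"
    by auto
  obtain a b where ab: "f x = ereal a" "g z = ereal b"
    using subdifferential_imp_finite[OF f u] subdifferential_imp_finite[OF g v]
      proper_fun_not_MInf[OF f, of x] proper_fun_not_MInf[OF g, of z]
    by (cases "f x"; cases "g z") auto
  have "f x + g z \<le> lagrangian f g A B c x' z' l" for x' z'
  proof -
    have "f x + ereal (- (transpose A *v l) \<bullet> (x' - x)) \<le> f x'"
      "g z + ereal ((transpose B *v l) \<bullet> (z' - z)) \<le> g z'"
      using u v by (simp_all add: subdifferential_def)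
    then show ?thesis
      using ab feas[symmetric] by (cases "f x'"; cases "g z'")
        (auto simp: lagrangian_def inner_diff_right inner_matrix_eq inner_commute)
  qed
  with feas show ?L
    unfolding saddle_point_iff_minimizer by simp
qed

section \<open>Weak and strong duality, optimality of saddle points\<close>

lemma fenchel_dual_lower_bound:
  "ereal (- (l \<bullet> (A *v x - B *v z - c))) - f x - g z \<le> fenchel_dual_objective f g A B c l"
proof -
  \<comment> \<open>Add Fenchel-Young for \<open>f\<close> and for \<open>g\<close>: together with
    \<open>l \<bullet> c\<close> the inner products collect into minus the Lagrangian, for all
    \<open>x\<close> and \<open>z\<close>, feasible or not.\<close>
  have "ereal (x \<bullet> - (transpose A *v l)) - f x \<le> fenchel_conj f (- (transpose A *v l))"
    "ereal (z \<bullet> (transpose B *v l)) - g z \<le> fenchel_conj g (transpose B *v l)"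
    by (rule fenchel_young)+
  then have "(ereal (x \<bullet> - (transpose A *v l)) - f x) + (ereal (z \<bullet> (transpose B *v l)) - g z)
      + ereal (l \<bullet> c) \<le> fenchel_dual_objective f g A B c l"
    unfolding fenchel_dual_objective_def by (intro add_mono) auto
  moreover have "(ereal (x \<bullet> - (transpose A *v l)) - f x) + (ereal (z \<bullet> (transpose B *v l)) - g z)
      + ereal (l \<bullet> c) = ereal (- (l \<bullet> (A *v x - B *v z - c))) - f x - g z"
    using proper_fun_not_MInf[OF f, of x] proper_fun_not_MInf[OF g, of z]
    by (cases "f x"; cases "g z") (auto simp: inner_diff_right inner_matrix_eq)
  ultimately show ?thesis
    by simp
qed

text \<open>Both Fenchel-Young inequalities are equalities at subgradients, and the remaining linear
  terms cancel by feasibility.\<close>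

lemma saddle_point_strong_duality:
  assumes "(x, z, l) \<in> saddle_points f g A B c"
  shows "fenchel_dual_objective f g A B c l = - (f x + g z)"
proof -
  obtain a b where ab: "f x = ereal a" "g z = ereal b"
    using saddle_point_finite[OF assms] .
  show ?thesis
    using assms unfolding saddle_point_iff_subgradients fenchel_dual_objective_def
    by (auto simp: ab fenchel_conj_subgradient inner_diff_right inner_matrix_eq)
qed

lemma saddle_point_primal_optimal:
  assumes "(x, z, l) \<in> saddle_points f g A B c"
  shows "(x, z) \<in> argmin_set (standard_feasible A B c) (standard_objective f g)"
proof -
  obtain a b where ab: "f x = ereal a" "g z = ereal b"
    using saddle_point_finite[OF assms] .
  have "A *v x - B *v z = c" and min: "\<And>x' z'. f x + g z \<le> lagrangian f g A B c x' z' l"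
    using assms unfolding saddle_point_iff_minimizer by auto
  moreover have "f x + g z \<le> f x' + g z'" if "A *v x' - B *v z' = c" for x' z'
    using min[of x' z'] that by (simp add: lagrangian_def)
  ultimately show ?thesis
    by (auto simp: argmin_set_def standard_feasible_def standard_objective_def ab)
qed

lemma saddle_point_dual_optimal:
  assumes "(x, z, l) \<in> saddle_points f g A B c"
  shows "l \<in> argmin_set UNIV (fenchel_dual_objective f g A B c)"
proof -
  obtain a b where ab: "f x = ereal a" "g z = ereal b"
    using saddle_point_finite[OF assms] .
  have "- (f x + g z) \<le> fenchel_dual_objective f g A B c l'" for l'
    using fenchel_dual_lower_bound[of l' x z] saddle_point_feasible[OF assms] by (simp add: ab)
  then show ?thesis
    by (auto simp: argmin_set_def saddle_point_strong_duality[OF assms] ab)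
qed

text \<open>The optimal pair has a value at most \<open>f x + g z\<close>, hence inherits the lower
  bound on the Lagrangian at the same multiplier.\<close>

lemma primal_optimal_imp_saddle_point:
  assumes saddle: "(x, z, l) \<in> saddle_points f g A B c"
    and opt: "(x', z') \<in> argmin_set (standard_feasible A B c) (standard_objective f g)"
  shows "(x', z', l) \<in> saddle_points f g A B c"
proof -
  have "A *v x' - B *v z' = c" "f x' + g z' \<le> f x + g z"
    using opt saddle_point_feasible[OF saddle]
    by (auto simp: argmin_set_def standard_feasible_def standard_objective_def)
  then show ?thesis
    using saddle unfolding saddle_point_iff_minimizer by (meson order_trans)
qed

text \<open>By strong duality the dual value at \<open>l'\<close> is at most
  \<open>- (f x + g z)\<close>. Weak duality at arbitrary, possibly infeasible, pairs then bounds
  the Lagrangian at \<open>l'\<close> from below by \<open>f x + g z\<close>.\<close>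

lemma dual_optimal_imp_saddle_point:
  assumes saddle: "(x, z, l) \<in> saddle_points f g A B c"
    and opt: "l' \<in> argmin_set UNIV (fenchel_dual_objective f g A B c)"
  shows "(x, z, l') \<in> saddle_points f g A B c"
proof -
  obtain a b where ab: "f x = ereal a" "g z = ereal b"
    using saddle_point_finite[OF saddle] .
  have "fenchel_dual_objective f g A B c l' \<le> fenchel_dual_objective f g A B c l"
    using opt by (simp add: argmin_set_def)
  also have "\<dots> = - (f x + g z)"
    using saddle by (rule saddle_point_strong_duality)
  finally have "ereal (- (l' \<bullet> (A *v x' - B *v z' - c))) - f x' - g z' \<le> - (f x + g z)" for x' z'
    using fenchel_dual_lower_bound order_trans by blast
  note bound = this
  have "f x + g z \<le> lagrangian f g A B c x' z' l'" for x' z'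
    using bound[of x' z'] ab proper_fun_not_MInf[OF f, of x'] proper_fun_not_MInf[OF g, of z']
    by (cases "f x'"; cases "g z'") (auto simp: lagrangian_def)
  then show ?thesis
    using saddle_point_feasible[OF saddle] unfolding saddle_point_iff_minimizer by simp
qed

end

section \<open>Changes of variables\<close>

text \<open>By \<open>adj\<close>, \<open>\<Lambda>\<close> is \<open>\<kappa>\<close> times the
  inverse adjoint of \<open>S\<close>. The pairing thus scales by the same factor as the objectives,
  and one \<open>\<kappa>\<close> serves the primal and the dual problem.\<close>

locale change_of_variables =
  fixes f :: "real^'n \<Rightarrow> ereal" and g :: "real^'m \<Rightarrow> ereal"
    and A :: "real^'n^'p" and B :: "real^'m^'p" and c :: "real^'p"
    and ft gt :: "real^'p \<Rightarrow> ereal"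
    and S \<Lambda> :: "real^'p \<Rightarrow> real^'p" and \<kappa> :: real
  assumes f: "proper_fun f" and g: "proper_fun g"
    and injA: "inj ((*v) A)" and injB: "inj ((*v) B)"
    and linS: "linear S" and bijS: "bij S" and bij\<Lambda>: "bij \<Lambda>" and \<kappa>: "0 < \<kappa>"
    and adj: "\<Lambda> l \<bullet> S y = \<kappa> * (l \<bullet> y)"
    and ft: "ft = (\<lambda>y. ereal \<kappa> * comp_inverse f (\<lambda>x. S (A *v x)) y)"
    and gt: "gt = (\<lambda>y. ereal \<kappa> * comp_inverse g (\<lambda>z. S (B *v z)) y)"
begin

lemma injSA: "inj (\<lambda>x. S (A *v x))" and injSB: "inj (\<lambda>z. S (B *v z))"
  using injA injB bij_is_inj[OF bijS] by (auto simp: inj_def)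

lemma ft_apply: "ft (S (A *v x)) = ereal \<kappa> * f x"
  unfolding ft using comp_inverse_apply[OF injSA] by simp

lemma gt_apply: "gt (S (B *v z)) = ereal \<kappa> * g z"
  unfolding gt using comp_inverse_apply[OF injSB] by simp

lemma ft_outside: "y \<notin> range (\<lambda>x. S (A *v x)) \<Longrightarrow> ft y = \<infinity>"
  unfolding ft using \<kappa> by (simp add: comp_inverse_outside)

lemma gt_outside: "y \<notin> range (\<lambda>z. S (B *v z)) \<Longrightarrow> gt y = \<infinity>"
  unfolding gt using \<kappa> by (simp add: comp_inverse_outside)

lemma proper_ft: "proper_fun ft" and proper_gt: "proper_fun gt"
  unfolding ft gt by (rule proper_fun_scaled_comp_inverse f g injSA injSB \<kappa>)+

lemma feasible_iff: "A *v x - B *v z = c \<longleftrightarrow> S (A *v x) - S c = S (B *v z)"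
proof -
  have "A *v x - B *v z = c \<longleftrightarrow> S (A *v x - c) = S (B *v z)"
    using inj_eq[OF bij_is_inj[OF bijS]] by (auto simp: algebra_simps)
  then show ?thesis
    by (simp add: linear_diff[OF linS])
qed

section \<open>Equivalence of the primal and of the dual problems\<close>

lemma equivalent_primal:
  "equivalent_problems \<kappa> (\<lambda>(x, z). S (A *v x)) (standard_feasible A B c) (standard_objective f g)
     UNIV (unified_primal ft gt (S c))"
proof (rule equivalent_problemsI[OF \<kappa>])
  show "inj_on (\<lambda>(x, z). S (A *v x)) (standard_feasible A B c)"
  proof (rule inj_onI, clarify)
    fix x z x' z'
    assume feas: "(x, z) \<in> standard_feasible A B c" "(x', z') \<in> standard_feasible A B c"
      and eq: "S (A *v x) = S (A *v x')"
    have "x = x'"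
      using eq injSA by (auto simp: inj_def)
    \<comment> \<open>The constraint recovers \<open>z\<close> from \<open>x\<close>, which is why a
      map of \<open>x\<close> alone is injective on the feasible set.\<close>
    moreover have "S (B *v z) = S (B *v z')"
      using feas eq by (auto simp: standard_feasible_def feasible_iff)
    then have "z = z'"
      using injSB by (auto simp: inj_def)
    ultimately show "x = x' \<and> z = z'" ..
  qed
next
  fix v assume "v \<in> standard_feasible A B c"
  then show "unified_primal ft gt (S c) ((\<lambda>(x, z). S (A *v x)) v)
      = ereal \<kappa> * standard_objective f g v"
    using \<kappa> by (cases v) (simp add: standard_feasible_def feasible_iff unified_primal_def
        standard_objective_def ft_apply gt_apply ereal_pos_distrib)
next
  fix w assume w: "w \<notin> (\<lambda>(x, z). S (A *v x)) ` standard_feasible A B c"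
  show "unified_primal ft gt (S c) w = \<infinity>"
  proof (rule ccontr)
    assume "unified_primal ft gt (S c) w \<noteq> \<infinity>"
    \<comment> \<open>Finite summands place \<open>w\<close> in the range of \<open>S A\<close> and
      \<open>w - S c\<close> in that of \<open>S B\<close>; the two preimages form a feasible
      pair.\<close>
    then have "ft w \<noteq> \<infinity>" "gt (w - S c) \<noteq> \<infinity>"
      by (auto simp: unified_primal_def)
    then obtain x z where xz: "w = S (A *v x)" "w - S c = S (B *v z)"
      using ft_outside[of w] gt_outside[of "w - S c"] by blast
    then have "(x, z) \<in> standard_feasible A B c"
      by (simp add: standard_feasible_def feasible_iff)
    with w xz(1) show False
      by force
  qed
qed simp

text \<open>The reflection of \<open>ft\<close> and the translation of \<open>gt\<close> are moved
  into the inverted maps, giving \<open>- S A\<close> and the affine map \<open>S B + S c\<close>;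
  the conjugation rule for \<open>comp_inverse\<close> then applies to both.\<close>

lemma unified_dual_apply:
  "unified_dual ft gt (S c) (\<Lambda> l) = ereal \<kappa> * fenchel_dual_objective f g A B c l"
proof -
  have "comp_inverse f (\<lambda>x. S (A *v x)) (- y) = comp_inverse f (\<lambda>x. - S (A *v x)) y" for y
  proof (cases "- y \<in> range (\<lambda>x. S (A *v x))")
    case True
    then obtain x where "y = - S (A *v x)"
      by (auto simp: minus_equation_iff[of y])
    then show ?thesis
      using comp_inverse_apply[OF injSA] comp_inverse_apply[of "\<lambda>x. - S (A *v x)" f x] injSA
      by (simp add: inj_def)
  next
    case False
    moreover from False have "y \<notin> range (\<lambda>x. - S (A *v x))"
      by auto
    ultimately show ?thesis
      by (simp add: comp_inverse_outside)
  qed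
  then have "ft \<circ> uminus = (\<lambda>y. ereal \<kappa> * comp_inverse f (\<lambda>x. - S (A *v x)) y)"
    by (simp add: ft comp_def)
  moreover have "- S (A *v x) \<bullet> \<Lambda> l = \<kappa> * (x \<bullet> - (transpose A *v l)) + 0" for x
    using adj[of l "A *v x"] by (simp add: inner_commute[of _ "\<Lambda> l"] inner_matrix_eq)
  moreover have "inj (\<lambda>x. - S (A *v x))"
    using injSA by (simp add: inj_def)
  ultimately have F: "fenchel_conj (ft \<circ> uminus) (\<Lambda> l)
      = ereal \<kappa> * fenchel_conj f (- (transpose A *v l))"
    using fenchel_conj_scaled_comp_inverse[OF _ \<kappa>,
        of "\<lambda>x. - S (A *v x)" "\<Lambda> l" "- (transpose A *v l)" 0 f]
    by simp
  have injc: "inj (\<lambda>z. S (B *v z) + S c)"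
    using injSB by (simp add: inj_def)
  have "comp_inverse g (\<lambda>z. S (B *v z)) (y - S c) = comp_inverse g (\<lambda>z. S (B *v z) + S c) y" for y
  proof (cases "y - S c \<in> range (\<lambda>z. S (B *v z))")
    case True
    then obtain z where "y = S (B *v z) + S c"
      by (auto simp: diff_eq_eq)
    then show ?thesis
      using comp_inverse_apply[OF injSB] comp_inverse_apply[OF injc] by simp
  next
    case False
    moreover from False have "y \<notin> range (\<lambda>z. S (B *v z) + S c)"
      by auto
    ultimately show ?thesis
      by (simp add: comp_inverse_outside)
  qed
  then have "(\<lambda>y. gt (y - S c)) = (\<lambda>y. ereal \<kappa> * comp_inverse g (\<lambda>z. S (B *v z) + S c) y)"
    by (simp add: gt)
  \<comment> \<open>The shift by \<open>S c\<close> supplies the constant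
    \<open>r = \<kappa> * (l \<bullet> c)\<close>, the linear term of the dual objective.\<close>
  moreover have "(S (B *v z) + S c) \<bullet> \<Lambda> l = \<kappa> * (z \<bullet> (transpose B *v l)) + \<kappa> * (l \<bullet> c)" for z
    using adj[of l "B *v z"] adj[of l c]
    by (simp add: inner_add_left inner_commute[of _ "\<Lambda> l"] inner_matrix_eq inner_add_right)
  ultimately have "fenchel_conj (\<lambda>y. gt (y - S c)) (\<Lambda> l)
      = ereal \<kappa> * fenchel_conj g (transpose B *v l) + ereal (\<kappa> * (l \<bullet> c))"
    using fenchel_conj_scaled_comp_inverse[OF injc \<kappa>,
        of "\<Lambda> l" "transpose B *v l" "\<kappa> * (l \<bullet> c)" g]
    by simp
  with F show ?thesis
    using \<kappa> by (simp add: unified_dual_def fenchel_dual_objective_def ereal_pos_distrib add.assoc)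
qed

lemma equivalent_dual:
  "equivalent_problems \<kappa> \<Lambda> UNIV (fenchel_dual_objective f g A B c) UNIV (unified_dual ft gt (S c))"
  by (rule equivalent_problemsI[OF \<kappa>])
    (use bij\<Lambda> unified_dual_apply in \<open>auto simp: bij_def\<close>)

section \<open>Subgradients after substitution and the two inclusions\<close>

lemma subdifferential_ft_iff:
  "- \<Lambda> l \<in> subdifferential ft (S (A *v x)) \<longleftrightarrow> - (transpose A *v l) \<in> subdifferential f x"
  unfolding ft
proof (rule subdifferential_scaled_comp_inverse[OF injSA \<kappa>])
  fix y
  show "- \<Lambda> l \<bullet> (S (A *v y) - S (A *v x)) = \<kappa> * (- (transpose A *v l) \<bullet> (y - x))"
    by (simp add: inner_diff_right adj inner_matrix_eq inner_commute[of _ "l v* A"]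
        algebra_simps)
qed

lemma subdifferential_gt_iff:
  "\<Lambda> l \<in> subdifferential gt (S (B *v z)) \<longleftrightarrow> transpose B *v l \<in> subdifferential g z"
  unfolding gt
proof (rule subdifferential_scaled_comp_inverse[OF injSB \<kappa>])
  fix y
  show "\<Lambda> l \<bullet> (S (B *v y) - S (B *v z)) = \<kappa> * ((transpose B *v l) \<bullet> (y - z))"
    by (simp add: inner_diff_right adj inner_matrix_eq inner_commute[of _ "l v* B"]
        algebra_simps)
qed

text \<open>Both inclusions are projections of this set of pairs: the primal one keeps
  \<open>y\<close> and has \<open>u\<close> as witness, the dual one keeps \<open>u\<close> and has
  \<open>y\<close> as witness.\<close>

lemma inclusion_pairs:
  "{(y, u). - u \<in> subdifferential ft y \<and> u \<in> subdifferential gt (y - S c)}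
    = (\<lambda>(x, z, l). (S (A *v x), \<Lambda> l)) ` saddle_points f g A B c" (is "?L = ?R")
proof (intro equalityI subsetI)
  fix p assume "p \<in> ?L"
  then obtain y u where p: "p = (y, u)"
    and u: "- u \<in> subdifferential ft y" "u \<in> subdifferential gt (y - S c)"
    by blast
  obtain l where l: "u = \<Lambda> l"
    using bij\<Lambda> by (metis bij_pointE)
  \<comment> \<open>Points with a subgradient have finite value, hence lie in the ranges of
    \<open>S A\<close> and \<open>S B\<close>.\<close>
  have "ft y \<noteq> \<infinity>" "gt (y - S c) \<noteq> \<infinity>"
    using subdifferential_imp_finite[OF proper_ft u(1)] subdifferential_imp_finite[OF proper_gt u(2)]
    by auto
  then obtain x z where xz: "y = S (A *v x)" "y - S c = S (B *v z)"
    using ft_outside[of y] gt_outside[of "y - S c"] by blast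
  have "(x, z, l) \<in> saddle_points f g A B c"
    using u xz unfolding saddle_point_iff_subgradients[OF f g] feasible_iff l
    by (simp add: subdifferential_ft_iff subdifferential_gt_iff)
  then show "p \<in> ?R"
    using p xz l by force
next
  fix p assume "p \<in> ?R"
  then obtain x z l where "p = (S (A *v x), \<Lambda> l)" "(x, z, l) \<in> saddle_points f g A B c"
    by auto
  then show "p \<in> ?L"
    unfolding saddle_point_iff_subgradients[OF f g] feasible_iff
    by (simp add: subdifferential_ft_iff subdifferential_gt_iff)
qed

lemma primal_inclusion:
  "primal_inclusion_solutions (subdifferential ft) (subdifferential gt) (S c)
    = (\<lambda>(x, z, l). S (A *v x)) ` saddle_points f g A B c"
proof -
  have "primal_inclusion_solutions (subdifferential ft) (subdifferential gt) (S c)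
      = fst ` {(y, u). - u \<in> subdifferential ft y \<and> u \<in> subdifferential gt (y - S c)}"
  proof (intro equalityI subsetI)
    fix y
    assume "y \<in> primal_inclusion_solutions (subdifferential ft) (subdifferential gt) (S c)"
    then obtain u v where "0 = v + u" "v \<in> subdifferential ft y" "u \<in> subdifferential gt (y - S c)"
      by (auto simp: primal_inclusion_solutions_def elim: set_plus_elim)
    then have "(y, u) \<in> {(y, u). - u \<in> subdifferential ft y \<and> u \<in> subdifferential gt (y - S c)}"
      using minus_unique[of u v] by (simp add: add.commute)
    then show "y \<in> fst ` {(y, u). - u \<in> subdifferential ft y \<and> u \<in> subdifferential gt (y - S c)}"
      by (rule rev_image_eqI) simp
  next
    fix y
    assume "y \<in> fst ` {(y, u). - u \<in> subdifferential ft y \<and> u \<in> subdifferential gt (y - S c)}"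
    then obtain u where "- u \<in> subdifferential ft y" "u \<in> subdifferential gt (y - S c)"
      by auto
    then have "- u + u \<in> subdifferential ft y + subdifferential gt (y - S c)"
      by (rule set_plus_intro)
    then show "y \<in> primal_inclusion_solutions (subdifferential ft) (subdifferential gt) (S c)"
      by (simp add: primal_inclusion_solutions_def)
  qed
  also have "\<dots> = (\<lambda>(x, z, l). S (A *v x)) ` saddle_points f g A B c"
    unfolding inclusion_pairs image_image by (rule image_cong) auto
  finally show ?thesis .
qed

lemma dual_inclusion:
  "dual_inclusion_solutions (subdifferential ft) (subdifferential gt) (S c)
    = (\<lambda>(x, z, l). \<Lambda> l) ` saddle_points f g A B c"
proof -
  have "dual_inclusion_solutions (subdifferential ft) (subdifferential gt) (S c)
      = snd ` {(y, u). - u \<in> subdifferential ft y \<and> u \<in> subdifferential gt (y - S c)}"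
  proof (intro equalityI subsetI)
    fix u
    assume "u \<in> dual_inclusion_solutions (subdifferential ft) (subdifferential gt) (S c)"
    \<comment> \<open>The Attouch-Thera inverse at \<open>u\<close> consists of the vectors
      \<open>- y\<close> with \<open>- u\<close> a subgradient at \<open>y\<close>, so a zero sum
      forces \<open>y' = y\<close>.\<close>
    then obtain y y' where "0 = - y + y'" "- u \<in> subdifferential ft y"
      "u \<in> subdifferential gt (y' - S c)"
      by (auto simp: dual_inclusion_solutions_def attouch_thera_inverse_def op_inverse_def
          elim!: set_plus_elim)
    then have "(y, u) \<in> {(y, u). - u \<in> subdifferential ft y \<and> u \<in> subdifferential gt (y - S c)}"
      using minus_unique[of "- y" y'] by simp
    then show "u \<in> snd ` {(y, u). - u \<in> subdifferential ft y \<and> u \<in> subdifferential gt (y - S c)}"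
      by (rule rev_image_eqI) simp
  next
    fix u
    assume "u \<in> snd ` {(y, u). - u \<in> subdifferential ft y \<and> u \<in> subdifferential gt (y - S c)}"
    then obtain y where "- u \<in> subdifferential ft y" "u \<in> subdifferential gt (y - S c)"
      by auto
    then have "- y + y \<in> attouch_thera_inverse (subdifferential ft) u
        + op_inverse (\<lambda>x. subdifferential gt (x - S c)) u"
      by (intro set_plus_intro) (auto simp: attouch_thera_inverse_def op_inverse_def)
    then show "u \<in> dual_inclusion_solutions (subdifferential ft) (subdifferential gt) (S c)"
      by (simp add: dual_inclusion_solutions_def)
  qed
  also have "\<dots> = (\<lambda>(x, z, l). \<Lambda> l) ` saddle_points f g A B c"
    unfolding inclusion_pairs image_image by (rule image_cong) auto
  finally show ?thesis .
qed

lemma primal_inclusion_optimal: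
  "primal_inclusion_solutions (subdifferential ft) (subdifferential gt) (S c)
    \<subseteq> (\<lambda>(x, z). S (A *v x)) ` argmin_set (standard_feasible A B c) (standard_objective f g)"
  unfolding primal_inclusion
  by (auto intro!: rev_image_eqI[OF saddle_point_primal_optimal[OF f g]])

lemma dual_inclusion_optimal:
  "dual_inclusion_solutions (subdifferential ft) (subdifferential gt) (S c)
    \<subseteq> \<Lambda> ` argmin_set UNIV (fenchel_dual_objective f g A B c)"
  unfolding dual_inclusion
  by (auto intro!: rev_image_eqI[OF saddle_point_dual_optimal[OF f g]])

text \<open>The multiplier of a single saddle point serves every primal solution, so each of them
  solves the inclusion.\<close>

lemma primal_inclusion_eq_optimal:
  assumes "saddle_points f g A B c \<noteq> {}"
  shows "primal_inclusion_solutions (subdifferential ft) (subdifferential gt) (S c)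
    = (\<lambda>(x, z). S (A *v x)) ` argmin_set (standard_feasible A B c) (standard_objective f g)"
proof (rule equalityI[OF primal_inclusion_optimal])
  obtain x z l where "(x, z, l) \<in> saddle_points f g A B c"
    using assms by auto
  then show "(\<lambda>(x, z). S (A *v x)) ` argmin_set (standard_feasible A B c) (standard_objective f g)
      \<subseteq> primal_inclusion_solutions (subdifferential ft) (subdifferential gt) (S c)"
    unfolding primal_inclusion
    by (auto intro!: rev_image_eqI[OF primal_optimal_imp_saddle_point[OF f g]])
qed

lemma dual_inclusion_eq_optimal:
  assumes "saddle_points f g A B c \<noteq> {}"
  shows "dual_inclusion_solutions (subdifferential ft) (subdifferential gt) (S c)
    = \<Lambda> ` argmin_set UNIV (fenchel_dual_objective f g A B c)"
proof (rule equalityI[OF dual_inclusion_optimal])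
  obtain x z l where "(x, z, l) \<in> saddle_points f g A B c"
    using assms by auto
  then show "\<Lambda> ` argmin_set UNIV (fenchel_dual_objective f g A B c)
      \<subseteq> dual_inclusion_solutions (subdifferential ft) (subdifferential gt) (S c)"
    unfolding dual_inclusion
    by (auto intro!: rev_image_eqI[OF dual_optimal_imp_saddle_point[OF f g]])
qed

end

section \<open>The adjoint of a bijection and the two parametrizations\<close>

lemma bij_adjoint:
  fixes S :: "'a::euclidean_space \<Rightarrow> 'a"
  assumes "linear S" and "surj S"
  shows "bij (adjoint S)"
proof -
  have lin: "linear (adjoint S)"
    using assms(1) by (rule adjoint_linear)
  have "inj (adjoint S)"
  proof (subst linear_injective_0[OF lin], intro allI impI)
    fix v
    assume "adjoint S v = 0"
    then have "S x \<bullet> v = 0" for x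
      using adjoint_works[OF assms(1), of x v] by simp
    \<comment> \<open>The kernel of the adjoint is orthogonal to the range of \<open>S\<close>;
      surjectivity allows \<open>S x = v\<close>.\<close>
    then have "v \<bullet> v = 0"
      using assms(2) by (metis surjD)
    then show "v = 0"
      by simp
  qed
  then show ?thesis
    using linear_injective_imp_surjective[OF lin] by (simp add: bij_def)
qed

text \<open>The inclusions encode optimality together with a multiplier, so they are matched with
  saddle points. Equality with the full solution sets is asserted when a saddle point exists, as a
  minimizer alone need not admit a multiplier.\<close>

theorem proposition7p1:
  fixes f :: "real^'n \<Rightarrow> ereal" and g :: "real^'m \<Rightarrow> ereal"
    and A :: "real^'n^'p" and B :: "real^'m^'p" and c :: "real^'p"
    and ft gt :: "real^'p \<Rightarrow> ereal"
    and X :: "real^'n \<Rightarrow> real^'p" and \<Lambda> :: "real^'p \<Rightarrow> real^'p"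
    and ct :: "real^'p" and \<kappa> :: real
  assumes f: "convex_closed_proper f" and g: "convex_closed_proper g"
    and A: "rank A = CARD('n)" and B: "rank B = CARD('m)"
    and substitution:
      "(\<exists>S :: real^'p \<Rightarrow> real^'p. bounded_linear S \<and> bij S \<and>
          ft = comp_inverse f (\<lambda>x. S (A *v x)) \<and>
          gt = comp_inverse g (\<lambda>z. S (B *v z)) \<and>
          X = (\<lambda>x. S (A *v x)) \<and> \<Lambda> = inv (adjoint S) \<and> ct = S c \<and> \<kappa> = 1) \<or>
       (\<exists>\<gamma> :: real. \<gamma> > 0 \<and>
          ft = (\<lambda>y. ereal (1 / \<gamma>) * comp_inverse f (\<lambda>x. A *v x) y) \<and>
          gt = (\<lambda>y. ereal (1 / \<gamma>) * comp_inverse g (\<lambda>z. B *v z) y) \<and>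
          X = (\<lambda>x. A *v x) \<and> \<Lambda> = (\<lambda>l. (1 / \<gamma>) *\<^sub>R l) \<and> ct = c \<and> \<kappa> = 1 / \<gamma>)"
  defines "\<A> \<equiv> subdifferential ft" and "\<B> \<equiv> subdifferential gt"
  shows
    "equivalent_problems \<kappa> (\<lambda>(x, z). X x)
       (standard_feasible A B c) (standard_objective f g)
       UNIV (unified_primal ft gt ct) \<and>
     equivalent_problems \<kappa> \<Lambda>
       UNIV (fenchel_dual_objective f g A B c)
       UNIV (unified_dual ft gt ct) \<and>
     monotone_operator \<A> \<and> monotone_operator \<B> \<and>
     primal_inclusion_solutions \<A> \<B> ct = (\<lambda>(x, z, l). X x) ` saddle_points f g A B c \<and>
     dual_inclusion_solutions \<A> \<B> ct = (\<lambda>(x, z, l). \<Lambda> l) ` saddle_points f g A B c \<and>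
     primal_inclusion_solutions \<A> \<B> ct \<subseteq>
       (\<lambda>(x, z). X x) ` argmin_set (standard_feasible A B c) (standard_objective f g) \<and>
     dual_inclusion_solutions \<A> \<B> ct \<subseteq>
       \<Lambda> ` argmin_set UNIV (fenchel_dual_objective f g A B c) \<and>
     (saddle_points f g A B c \<noteq> {} \<longrightarrow>
       primal_inclusion_solutions \<A> \<B> ct =
         (\<lambda>(x, z). X x) ` argmin_set (standard_feasible A B c) (standard_objective f g) \<and>
       dual_inclusion_solutions \<A> \<B> ct =
         \<Lambda> ` argmin_set UNIV (fenchel_dual_objective f g A B c))"
proof -
  have proper: "proper_fun f" "proper_fun g"
    using f g by (auto simp: convex_closed_proper_def)
  have inj: "inj ((*v) A)" "inj ((*v) B)"
    using A B by (auto simp: full_rank_injective)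
  obtain S where X: "X = (\<lambda>x. S (A *v x))" and ct: "ct = S c"
    and "change_of_variables f g A B ft gt S \<Lambda> \<kappa>"
    using substitution
  proof (elim disjE exE conjE)
    fix S :: "real^'p \<Rightarrow> real^'p"
    assume S: "bounded_linear S" "bij S"
      and eqs: "ft = comp_inverse f (\<lambda>x. S (A *v x))" "gt = comp_inverse g (\<lambda>z. S (B *v z))"
        "X = (\<lambda>x. S (A *v x))" "\<Lambda> = inv (adjoint S)" "ct = S c" "\<kappa> = 1"
    have lin: "linear S"
      using S(1) by (rule bounded_linear.linear)
    have bij: "bij (adjoint S)"
      using bij_adjoint[OF lin] bij_is_surj[OF S(2)] .
    \<comment> \<open>Move \<open>S\<close> across the inner product; its adjoint undoes
      \<open>\<Lambda>\<close>.\<close>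
    have "\<Lambda> l \<bullet> S y = l \<bullet> y" for l y
      using adjoint_works[OF lin, of y "\<Lambda> l"] surj_f_inv_f[OF bij_is_surj[OF bij], of l]
      by (simp add: eqs(4) inner_commute)
    then have "change_of_variables f g A B ft gt S \<Lambda> \<kappa>"
      using proper inj lin S(2) bij_imp_bij_inv[OF bij] eqs
      by (simp add: change_of_variables_def one_ereal_def[symmetric])
    with eqs show thesis
      by (intro that)
  next
    fix \<gamma> :: real
    assume \<gamma>: "\<gamma> > 0"
      and eqs: "ft = (\<lambda>y. ereal (1 / \<gamma>) * comp_inverse f (\<lambda>x. A *v x) y)"
        "gt = (\<lambda>y. ereal (1 / \<gamma>) * comp_inverse g (\<lambda>z. B *v z) y)"
        "X = (\<lambda>x. A *v x)" "\<Lambda> = (\<lambda>l. (1 / \<gamma>) *\<^sub>R l)" "ct = c" "\<kappa> = 1 / \<gamma>"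
    \<comment> \<open>In the classical case \<open>S\<close> is the identity and
      \<open>\<Lambda>\<close> scales by \<open>\<kappa> = 1 / \<gamma>\<close>, so
      \<open>adj\<close> is homogeneity of the inner product.\<close>
    have "bij \<Lambda>"
      unfolding eqs by (rule bij_betw_byWitness[where f' = "\<lambda>l. \<gamma> *\<^sub>R l"]) (use \<gamma> in auto)
    then have "change_of_variables f g A B ft gt id \<Lambda> \<kappa>"
      using proper inj \<gamma> eqs by (simp add: change_of_variables_def linear_id)
    with eqs show thesis
      by (intro that[of id]) auto
  qed
  then interpret change_of_variables f g A B c ft gt S \<Lambda> \<kappa>
    by simp
  show ?thesis
    unfolding \<A>_def \<B>_def X ct
    by (intro conjI impI equivalent_primal equivalent_dual monotone_subdifferential proper_ft
        proper_gt primal_inclusion dual_inclusion primal_inclusion_optimal dual_inclusion_optimal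
        primal_inclusion_eq_optimal dual_inclusion_eq_optimal)
qed

end
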